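(* Let $S$ be a finite set with $|S|=n\ge 1$, and let $D_{\mathrm{SO}}^S=(N,A)$ be the semiorder network of $S$ (defined in the context), with source $s=(\varnothing,\varnothing,\varnothing)$ and sink $t=(S,S,\varnothing)$. Let $\pi:\mathbb{R}^A\to\mathbb{R}^{S\star S}$ be the linear map sending $\Phi\in\mathbb{R}^A$ to the point $x\in\mathbb{R}^{S\star S}$ given, for all distinct $i,j\in S$, by $$x_{(i,j)}:=\sum\{\Phi_a : a=((X,Y,L),(Z,T,M))\in A,\ i\in Y,\ j\in Z\setminus X\}.$$ Then $\pi$ maps the flow polytope $F(D_{\mathrm{SO}}^S)$ onto the semiorder polytope $P_{\mathrm{SO}}^S$, i.e. $\pi(F(D_{\mathrm{SO}}^S))=P_{\mathrm{SO}}^S$. Thus, $F(D_{\mathrm{SO}}^S)$ (with its canonical description) is an extended formulation of $P_{\mathrm{SO}}^S$, of size $|A|\le e^2\,n\,n!$.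
   Context: Notation: $S\star S:=(S\times S)\setminus\{(i,i): i\in S\}$; $e$ is the base of the natural logarithm. Linear orders are strict: irreflexive, transitive, and complete (any two distinct elements are comparable). Semiorder network $D_{\mathrm{SO}}^S=(N,A)$: $N=\{(X,Y,L) : Y\subseteq X\subseteq S,\ L \text{ a linear order on } X\setminus Y\}$ (so $L=\varnothing$ when $X=Y$). A pair $((X,Y,L),(Z,T,M))$ of nodes is an arc in $A$ exactly in the following two cases: ($\alpha$) for some $i\in S\setminus X$: $Z=X\cup\{i\}$, $T=Y$, and $M=L+i$, the linear order on $Z\setminus T$ obtained by appending $i$ at the end (as last element) of $L$; ($\beta$) $X\setminus Y\neq\varnothing$ and, for the element $j\in X\setminus Y$ that is first in $L$: $Z=X$, $T=Y\cup\{j\}$, and $M=L-j$, the linear order induced by $L$ on $Z\setminus T=(X\setminus Y)\setminus\{j\}$. Semiorder polytope: a relation $R$ on $S$ is a semiorder if there exist mappings $\ell,h:S\to\mathbb{R}$ and a real number $r\ge0$ such that for all $i,j\in S$, $h(i)-\ell(i)=r$ and ($i\,R\,j\iff h(i)<\ell(j)$). Equivalently, $R$ is irreflexive and, for all $i,j,i',j',i''\in S$: ($i\,R\,j$ and $i'\,R\,j'$) implies ($i\,R\,j'$ or $i'\,R\,j$); and ($i\,R\,i'$ and $i'\,R\,i''$) implies ($i\,R\,j$ or $j\,R\,i''$). For an irreflexive relation $R$ on $S$, its characteristic vector $x^R\in\mathbb{R}^{S\star S}$ has coordinates $(x^R)_{(i,j)}=1$ if $i\,R\,j$ and $0$ otherwise.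 $P_{\mathrm{SO}}^S$ is the convex hull of the vectors $x^R$, for $R$ ranging over all semiorders on $S$. Flow polytope: let $D=(N,A)$ be an acyclic network (directed graph) with node set $N$, arc set $A$, source $s$ and sink $t$. For a node $v$, $\delta^+(v)$ and $\delta^-(v)$ are the sets of arcs leaving and entering $v$; for $\Phi\in\mathbb{R}^A$ and $B\subseteq A$, $\Phi(B):=\sum_{a\in B}\Phi_a$. The flow polytope $F(D)\subseteq\mathbb{R}^A$ is the polytope whose vertices are the characteristic vectors (in $\{0,1\}^A$) of the arc sets of all directed $s$–$t$ paths in $D$. Its canonical description (a standard fact) is the linear system $$\Phi(\delta^+(v))-\Phi(\delta^-(v))=0\ \ (v\in N\setminus\{s,t\}),\qquad \Phi(\delta^+(s))-\Phi(\delta^-(s))=1,\qquad \Phi_a\ge 0\ \ (a\in A),$$ whose solution set is $F(D)$. Extended formulation: an extended formulation of a polytope $P$ is a linear description (finite system of linear equations and inequalities) of a polytope $Q$ such that some affine map sends $Q$ onto $P$. The size of a linear description is its number of inequalities (equations and variables are not counted); so the canonical description of $F(D)$ has size $|A|$. *)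

theory Defs
  imports
    "HOL-Analysis.Analysis"
    "HOL-Library.Function_Algebras"
    "Graph_Theory.Graph_Theory"
begin

text \<open>
  For a finite index set \<open>I\<close> of type \<open>'i set\<close>, the space $\mathbb{R}^I$ is represented by the
  functions \<open>'i \<Rightarrow> real\<close> that vanish outside \<open>I\<close>. The pointwise vector space structure on
  functions makes \<open>convex hull\<close>, \<open>polytope\<close>, \<open>linear\<close> etc. available.
\<close>

instantiation "fun" :: (type, real_vector) real_vector
begin

definition scaleR_fun :: "real \<Rightarrow> ('a \<Rightarrow> 'b) \<Rightarrow> 'a \<Rightarrow> 'b" where
  "scaleR_fun r f = (\<lambda>x. r *\<^sub>R f x)"

instance
  by standard (simp_all add: scaleR_fun_def fun_eq_iff scaleR_add_right scaleR_add_left)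

end

lemma scaleR_fun_apply [simp]: "(r *\<^sub>R f) x = r *\<^sub>R f x"
  by (simp add: scaleR_fun_def)

text \<open>
  A pair \<open>(c, b)\<close> stands for the equation $\sum_i c_i x_i = b$ in \<open>lin_eqs\<close>, and for the inequality
  $\sum_i c_i x_i \ge b$ in \<open>lin_ineqs\<close>, where $i$ ranges over the index set \<open>lin_vars\<close>.
\<close>

record 'i linear_system =
  lin_vars :: "'i set"
  lin_eqs :: "(('i \<Rightarrow> real) \<times> real) set"
  lin_ineqs :: "(('i \<Rightarrow> real) \<times> real) set"

definition finite_system :: "'i linear_system \<Rightarrow> bool" where
  "finite_system \<L> \<longleftrightarrow> finite (lin_vars \<L>) \<and> finite (lin_eqs \<L>) \<and> finite (lin_ineqs \<L>)"

definition solutions :: "'i linear_system \<Rightarrow> ('i \<Rightarrow> real) set" where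
  "solutions \<L> = {x. (\<forall>i. i \<notin> lin_vars \<L> \<longrightarrow> x i = 0) \<and>
     (\<forall>(c, b) \<in> lin_eqs \<L>. (\<Sum>i\<in>lin_vars \<L>. c i * x i) = b) \<and>
     (\<forall>(c, b) \<in> lin_ineqs \<L>. (\<Sum>i\<in>lin_vars \<L>. c i * x i) \<ge> b)}"

definition system_size :: "'i linear_system \<Rightarrow> nat" where
  "system_size \<L> = card (lin_ineqs \<L>)"

definition affine_map :: "('a::real_vector \<Rightarrow> 'b::real_vector) \<Rightarrow> bool" where
  "affine_map f \<longleftrightarrow> (\<exists>g c. linear g \<and> f = (\<lambda>x. g x + c))"

definition extended_formulation :: "'i linear_system \<Rightarrow> 'b::real_vector set \<Rightarrow> bool" where
  "extended_formulation \<L> P \<longleftrightarrow> polytope P \<and> finite_system \<L> \<and> polytope (solutions \<L>) \<and>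
     (\<exists>f. affine_map f \<and> f ` solutions \<L> = P)"

definition flow_polytope :: "('v, 'e) pre_digraph \<Rightarrow> 'v \<Rightarrow> 'v \<Rightarrow> ('e \<Rightarrow> real) set" where
  "flow_polytope D s t = convex hull {indicator (set p) | p. pre_digraph.apath D s p t}"

text \<open>
  The generators of the convex hull are exactly the vertices of the flow polytope, as for any
  set of vectors with entries in $\{0,1\}$.
\<close>

lemma extreme_points_flow_polytope:
  fixes D :: "('v, 'e) pre_digraph"
  shows "{x. x extreme_point_of flow_polytope D s t} =
     {indicator (set p) | p. pre_digraph.apath D s p t}"
proof -
  define V :: "('e \<Rightarrow> real) set" where "V = {indicator (set p) | p. pre_digraph.apath D s p t}"
  define C :: "('e \<Rightarrow> real) set" where "C = {f. \<forall>a. 0 \<le> f a \<and> f a \<le> 1}"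
  have "convex C"
    unfolding convex_alt C_def by (auto simp: convex_bound_le)
  moreover have "V \<subseteq> C"
    by (auto simp: V_def C_def indicator_def)
  ultimately have VC: "convex hull V \<subseteq> C"
    by (rule hull_minimal[rotated])
  have "x extreme_point_of convex hull V" if "x \<in> V" for x
  proof -
    have False if a: "a \<in> C" and b: "b \<in> C" and x: "x \<in> open_segment a b" for a b
    proof -
      obtain u where u: "0 < u" "u < 1" "x = (1 - u) *\<^sub>R a + u *\<^sub>R b" and "a \<noteq> b"
        using x by (auto simp: in_segment)
      have "a e = b e" for e
      proof -
        have e: "0 \<le> a e" "a e \<le> 1" "0 \<le> b e" "b e \<le> 1"
          using a b by (auto simp: C_def)
        have xe: "x e = (1 - u) * a e + u * b e"
          using u(3) by simp
        have "x e = 0 \<or> x e = 1"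
          using \<open>x \<in> V\<close> by (auto simp: V_def indicator_def)
        then show ?thesis
        proof
          assume "x e = 0"
          moreover have "(1 - u) * a e \<ge> 0" "u * b e \<ge> 0"
            using u e by auto
          ultimately have "(1 - u) * a e = 0" "u * b e = 0"
            using xe by linarith+
          then show ?thesis using u by auto
        next
          assume "x e = 1"
          then have "(1 - u) * (1 - a e) + u * (1 - b e) = 0"
            using xe by (simp add: algebra_simps)
          moreover have "(1 - u) * (1 - a e) \<ge> 0" "u * (1 - b e) \<ge> 0"
            using u e by auto
          ultimately have "(1 - u) * (1 - a e) = 0" "u * (1 - b e) = 0"
            by linarith+
          then show ?thesis using u by auto
        qed
      qed
      with \<open>a \<noteq> b\<close> show False by auto
    qed
    moreover have "x \<in> convex hull V"
      using that by (rule hull_inc)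
    ultimately show ?thesis
      using VC by (auto simp: extreme_point_of_def)
  qed
  then show ?thesis
    unfolding flow_polytope_def V_def[symmetric]
    using extreme_point_of_convex_hull by blast
qed

definition canonical_description ::
  "('v, 'e) pre_digraph \<Rightarrow> 'v \<Rightarrow> 'v \<Rightarrow> 'e linear_system" where
  "canonical_description D s t =
     \<lparr> lin_vars = arcs D,
       lin_eqs =
         {(\<lambda>a. indicator (out_arcs D v) a - indicator (in_arcs D v) a, 0) | v.
            v \<in> verts D - {s, t}} \<union>
         {(\<lambda>a. indicator (out_arcs D s) a - indicator (in_arcs D s) a, 1)},
       lin_ineqs = {(indicator {a}, 0) | a. a \<in> arcs D} \<rparr>"

lemma solutions_canonical_description:
  fixes D :: "('v, 'e) pre_digraph"
  assumes "finite (arcs D)"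
  shows "\<Phi> \<in> solutions (canonical_description D s t) \<longleftrightarrow>
    (\<forall>a. a \<notin> arcs D \<longrightarrow> \<Phi> a = 0) \<and>
    (\<forall>v \<in> verts D - {s, t}. sum \<Phi> (out_arcs D v) - sum \<Phi> (in_arcs D v) = 0) \<and>
    sum \<Phi> (out_arcs D s) - sum \<Phi> (in_arcs D s) = 1 \<and>
    (\<forall>a \<in> arcs D. \<Phi> a \<ge> 0)"
proof -
  have eq: "(\<Sum>a\<in>arcs D. (indicator (out_arcs D v) a - indicator (in_arcs D v) a) * \<Phi> a) =
      sum \<Phi> (out_arcs D v) - sum \<Phi> (in_arcs D v)" for v
  proof -
    have "arcs D \<inter> out_arcs D v = out_arcs D v" "arcs D \<inter> in_arcs D v = in_arcs D v"
      by auto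
    then show ?thesis
      using assms by (simp add: left_diff_distrib sum_subtractf sum.If_cases indicator_def
          if_distrib[of "\<lambda>c. c * _"] Int_def cong: if_cong)
  qed
  have ineq: "(\<Sum>a'\<in>arcs D. indicator {a} a' * \<Phi> a') = \<Phi> a" if "a \<in> arcs D" for a
    using assms that by (simp add: indicator_def if_distrib[of "\<lambda>c. c * _"] cong: if_cong)
  have ball_v: "(\<forall>p\<in>{(f v, c) | v. v \<in> B}. Q p) \<longleftrightarrow> (\<forall>v\<in>B. Q (f v, c))"
    for f :: "'v \<Rightarrow> 'e \<Rightarrow> real" and B c and Q :: "('e \<Rightarrow> real) \<times> real \<Rightarrow> bool"
    by blast
  have ball_e: "(\<forall>p\<in>{(f a, c) | a. a \<in> B}. Q p) \<longleftrightarrow> (\<forall>a\<in>B. Q (f a, c))"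
    for f :: "'e \<Rightarrow> 'e \<Rightarrow> real" and B c and Q :: "('e \<Rightarrow> real) \<times> real \<Rightarrow> bool"
    by blast
  show ?thesis
    unfolding solutions_def canonical_description_def linear_system.simps mem_Collect_eq
      ball_Un ball_v ball_e prod.case eq
    using ineq by (auto simp: eq)
qed

type_synonym 'a so_node = "'a set \<times> 'a set \<times> 'a rel"

definition so_nodes :: "'a set \<Rightarrow> 'a so_node set" where
  "so_nodes S = {(X, Y, L). Y \<subseteq> X \<and> X \<subseteq> S \<and>
     L \<subseteq> (X - Y) \<times> (X - Y) \<and> strict_linear_order_on (X - Y) L}"

text \<open>
  In a node \<open>(X, Y, L)\<close>, \<open>X\<close> collects the intervals that have been opened and \<open>Y\<close> those that have been
  closed; \<open>L\<close> is the queue of open intervals. An arc opens a new interval, which joins the end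
  of the queue, or closes the first one in the queue.
\<close>

definition so_open :: "'a set \<Rightarrow> 'a so_node \<Rightarrow> 'a so_node \<Rightarrow> bool" where
  "so_open S = (\<lambda>(X, Y, L) (Z, T, M).
     \<exists>i \<in> S - X. Z = X \<union> {i} \<and> T = Y \<and> M = L \<union> (X - Y) \<times> {i})"

definition so_close :: "'a so_node \<Rightarrow> 'a so_node \<Rightarrow> bool" where
  "so_close = (\<lambda>(X, Y, L) (Z, T, M).
     \<exists>j \<in> X - Y. (\<forall>k \<in> X - Y - {j}. (j, k) \<in> L) \<and>
       Z = X \<and> T = Y \<union> {j} \<and> M = L \<inter> (X - Y - {j}) \<times> (X - Y - {j}))"

definition so_network :: "'a set \<Rightarrow> ('a so_node, 'a so_node \<times> 'a so_node) pre_digraph" where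
  "so_network S =
     \<lparr> verts = so_nodes S,
       arcs = {(u, v). u \<in> so_nodes S \<and> v \<in> so_nodes S \<and> (so_open S u v \<or> so_close u v)},
       tail = fst, head = snd \<rparr>"

definition so_source :: "'a so_node" where
  "so_source = ({}, {}, {})"

definition so_sink :: "'a set \<Rightarrow> 'a so_node" where
  "so_sink S = (S, S, {})"

lemma digraph_so_network:
  assumes "finite S"
  shows "digraph (so_network S)"
proof -
  have "so_nodes S \<subseteq> Pow S \<times> Pow S \<times> Pow (S \<times> S)"
    by (auto simp: so_nodes_def)
  then have fin: "finite (so_nodes S)"
    by (rule finite_subset) (use assms in simp)
  have "arcs (so_network S) \<subseteq> so_nodes S \<times> so_nodes S"
    by (auto simp: so_network_def)
  then have "finite (arcs (so_network S))"
    by (rule finite_subset) (use fin in simp)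
  with fin show ?thesis
    by unfold_locales
      (auto simp: so_network_def so_open_def so_close_def arc_to_ends_def)
qed

lemma acyclic_so_network:
  assumes "finite S"
  shows "acyclic (arcs_ends (so_network S))"
proof -
  define f :: "'a so_node \<Rightarrow> nat" where "f = (\<lambda>(X, Y, L). card X + card Y)"
  have "f u < f v" if "(u, v) \<in> arcs_ends (so_network S)" for u v
  proof -
    obtain X Y L Z T M where uv: "u = (X, Y, L)" "v = (Z, T, M)"
      by (metis prod_cases3)
    with that have X: "X \<subseteq> S" "Y \<subseteq> X" and "so_open S u v \<or> so_close u v"
      by (auto simp: arcs_ends_conv so_network_def so_nodes_def)
    moreover have "finite X" "finite Y"
      using X assms by (meson finite_subset)+
    ultimately show ?thesis
      by (auto simp: uv f_def so_open_def so_close_def)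
  qed
  then have "arcs_ends (so_network S) \<subseteq> inv_image less_than f"
    by auto
  then show ?thesis
    by (rule acyclic_subset[rotated]) (simp add: wf_acyclic)
qed

definition semiorder_on :: "'a set \<Rightarrow> 'a rel \<Rightarrow> bool" where
  "semiorder_on S R \<longleftrightarrow> R \<subseteq> S \<times> S \<and>
     (\<exists>(l :: 'a \<Rightarrow> real) (h :: 'a \<Rightarrow> real) (r :: real). r \<ge> 0 \<and>
        (\<forall>i\<in>S. \<forall>j\<in>S. h i - l i = r \<and> ((i, j) \<in> R \<longleftrightarrow> h i < l j)))"

text \<open>
  Semiorders are irreflexive, so their indicator functions vanish outside $S \star S$.
\<close>

definition semiorder_polytope :: "'a set \<Rightarrow> ('a \<times> 'a \<Rightarrow> real) set" where
  "semiorder_polytope S = convex hull {indicator R | R. semiorder_on S R}"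

definition so_projection ::
  "'a set \<Rightarrow> ('a so_node \<times> 'a so_node \<Rightarrow> real) \<Rightarrow> ('a \<times> 'a \<Rightarrow> real)" where
  "so_projection S \<Phi> = (\<lambda>(i, j).
     if i \<in> S \<and> j \<in> S \<and> i \<noteq> j
     then \<Sum>a \<in> {((X, Y, L), (Z, T, M)) \<in> arcs (so_network S). i \<in> Y \<and> j \<in> Z - X}. \<Phi> a
     else 0)"

lemma linear_so_projection: "linear (so_projection S)"
  by (rule linearI)
    (auto simp: so_projection_def fun_eq_iff sum.distrib sum_distrib_left)

end

theory Submission
  imports Defs
begin

text \<open>
  A flow in an acyclic network decomposes into source-sink paths, which gives the canonical
  description. Since \<open>so_projection\<close> is linear, it remains to see that it maps path vectors exactly to
  semiorder vectors. A path is a schedule of openings and closings in first-in-first-out order, and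
  $x_{(i,j)} = 1$ means that \<open>i\<close> is closed before \<open>j\<close> is opened. Such a schedule can be timed so that
  every element stays open for exactly one unit of time, which is a semiorder representation;
  conversely, sweeping over intervals of equal length yields a schedule.

  Both kinds of arcs are determined by a set \<open>Y\<close> of closed elements and a nonempty queue of distinct
  elements outside \<open>Y\<close>; counting these pairs gives at most $n! (\sum_{k<n} 1/k!)^2$ arcs of each kind.
  This implies the bound $e^2 n\, n!$ directly for $n \ge 2$, while for $n = 1$ it uses $2 \le e^2$.
\<close>

section \<open>Flows in acyclic networks\<close>

definition net_outflow :: "('v, 'e) pre_digraph \<Rightarrow> ('e \<Rightarrow> real) \<Rightarrow> 'v \<Rightarrow> real" where
  "net_outflow D \<Phi> v = sum \<Phi> (out_arcs D v) - sum \<Phi> (in_arcs D v)"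

lemma linear_net_outflow: "linear (\<lambda>\<Phi>. net_outflow D \<Phi> v)"
  by (rule linearI)
    (auto simp: net_outflow_def sum.distrib sum_distrib_left right_diff_distrib)

context fin_digraph
begin

text \<open>Each arc is counted once at its tail and once at its head. This settles the balance at
  the sink, on which the canonical description imposes no equation.\<close>

lemma sum_net_outflow: "(\<Sum>v\<in>verts G. net_outflow G \<Phi> v) = 0"
proof -
  have "(\<Sum>v\<in>verts G. sum \<Phi> (out_arcs G v)) = sum \<Phi> (arcs G)"
    unfolding out_arcs_def by (rule sum.group) auto
  moreover have "(\<Sum>v\<in>verts G. sum \<Phi> (in_arcs G v)) = sum \<Phi> (arcs G)"
    unfolding in_arcs_def by (rule sum.group) auto
  ultimately show ?thesis
    by (simp add: net_outflow_def sum_subtractf)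
qed

text \<open>A single arc contributes 1 at its tail and -1 at its head; along a path these
  contributions telescope.\<close>

lemma net_outflow_apath:
  assumes "apath u p w"
  shows "net_outflow G (indicator (set p)) v = (if v = u then 1 else 0) - (if v = w then 1 else 0)"
  using assms
proof (induction p arbitrary: u)
  case Nil
  then show ?case
    by (simp add: apath_Nil_iff net_outflow_def)
next
  case (Cons a p)
  then have a: "a \<in> arcs G" "tail G a = u" "apath (head G a) p w"
      "u \<notin> set (awalk_verts (head G a) p)"
    by (auto simp: apath_Cons_iff)
  \<comment> \<open>The rest of the path avoids \<open>u\<close>, the tail of \<open>a\<close>, so
    \<open>a\<close> does not recur and the indicator splits as a sum.\<close>
  then have "a \<notin> set p"
    using set_awalk_verts[of "head G a" p w] by (auto simp: apath_def)
  then have "indicator (set (a # p)) = (indicator {a} + indicator (set p) :: _ \<Rightarrow> real)"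
    by (auto simp: fun_eq_iff indicator_def)
  then have "net_outflow G (indicator (set (a # p))) v =
      net_outflow G (indicator {a}) v + net_outflow G (indicator (set p)) v"
    using linear_add[OF linear_net_outflow] by metis
  moreover have "net_outflow G (indicator {a}) v =
      (if v = u then 1 else 0) - (if v = head G a then 1 else 0)"
  proof -
    have "sum (indicator {a}) B = (if a \<in> B then 1 else 0 :: real)" if "finite B" for B
      using that by (simp add: indicator_def of_bool_def)
    then show ?thesis
      using a by (auto simp: net_outflow_def finite_out_arcs finite_in_arcs)
  qed
  ultimately show ?case
    using Cons.IH[OF a(3)] by simp
qed

section \<open>Acyclicity and nonnegative flows\<close>

lemma wf_converse_arcs_ends:
  assumes "acyclic (arcs_ends G)"
  shows "wf ((arcs_ends G)\<inverse>)"
  using assms by (intro finite_acyclic_wf_converse) (auto simp: arcs_ends_def)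

lemma no_closed_awalk:
  assumes "acyclic (arcs_ends G)" and "awalk u p u"
  shows "p = []"
  using assms reachable1_awalkI by (auto simp: acyclic_def)

text \<open>A repeated vertex would cut out a nonempty closed subwalk. Walks, which are easier to
  build, can thus stand in for paths.\<close>

lemma acyclic_awalk_imp_apath:
  assumes "acyclic (arcs_ends G)" and "awalk u p v"
  shows "apath u p v"
  using assms awalk_not_distinct_decomp[OF assms(2)] no_closed_awalk[OF assms(1)]
  by (auto simp: apath_def)

text \<open>Induction against the arcs: if all successors of \<open>v\<close> have outflow 0,
  balance makes their inflow 0, and nonnegativity then makes every arc leaving \<open>v\<close>
  carry 0.\<close>

lemma circulation_eq_0:
  assumes acyclic: "acyclic (arcs_ends G)"
    and nonneg: "\<And>a. a \<in> arcs G \<Longrightarrow> \<Phi> a \<ge> 0"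
    and net: "\<And>v. v \<in> verts G \<Longrightarrow> net_outflow G \<Phi> v = 0"
    and "a \<in> arcs G"
  shows "\<Phi> a = 0"
proof -
  have nn: "sum \<Phi> (out_arcs G v) \<ge> 0" for v
    by (rule sum_nonneg) (use nonneg in auto)
  have "v \<in> verts G \<longrightarrow> sum \<Phi> (out_arcs G v) = 0" for v
  proof (induction v rule: wf_induct_rule[OF wf_converse_arcs_ends[OF acyclic]])
    case (1 v)
    have "\<Phi> a = 0" if a: "a \<in> out_arcs G v" for a
    proof -
      have "(v, head G a) \<in> arcs_ends G" "head G a \<in> verts G"
        using a by (auto simp: arcs_ends_conv)
      then have "sum \<Phi> (in_arcs G (head G a)) = 0"
        using 1 net by (auto simp: net_outflow_def)
      moreover have "a \<in> in_arcs G (head G a)"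
        using a by auto
      ultimately show ?thesis
        using nonneg by (subst (asm) sum_nonneg_eq_0_iff) auto
    qed
    then show ?case by simp
  qed
  then have "sum \<Phi> (out_arcs G (tail G a)) = 0"
    using assms by simp
  then show ?thesis
    using assms nonneg by (subst (asm) sum_nonneg_eq_0_iff) auto
qed

text \<open>Flow that enters a vertex other than \<open>t\<close> must leave it, so a walk along
  positive arcs can be continued until it ends in \<open>t\<close>, as acyclicity forces it
  to.\<close>

lemma positive_apath:
  assumes acyclic: "acyclic (arcs_ends G)"
    and nonneg: "\<And>a. a \<in> arcs G \<Longrightarrow> \<Phi> a \<ge> 0"
    and net: "\<And>v. v \<in> verts G \<Longrightarrow> v \<noteq> t \<Longrightarrow> net_outflow G \<Phi> v \<ge> 0"
    and s: "s \<in> verts G" "net_outflow G \<Phi> s > 0"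
  shows "\<exists>p. apath s p t \<and> (\<forall>a\<in>set p. \<Phi> a > 0)"
proof -
  \<comment> \<open>The disjunct \<open>v = t\<close> lets the induction stop with the empty
    walk.\<close>
  have *: "v \<in> verts G \<longrightarrow> v = t \<or> sum \<Phi> (out_arcs G v) > 0 \<longrightarrow>
      (\<exists>p. awalk v p t \<and> (\<forall>a\<in>set p. \<Phi> a > 0))" for v
  proof (induction v rule: wf_induct_rule[OF wf_converse_arcs_ends[OF acyclic]])
    case (1 v)
    show ?case
    proof (intro impI)
      assume v: "v \<in> verts G" and or: "v = t \<or> sum \<Phi> (out_arcs G v) > 0"
      show "\<exists>p. awalk v p t \<and> (\<forall>a\<in>set p. \<Phi> a > 0)"
      proof (cases "v = t")
        case True
        with v show ?thesis
          by (intro exI[of _ "[]"]) (simp add: awalk_Nil_iff)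
      next
        case False
        with or have "sum \<Phi> (out_arcs G v) > 0" by simp
        then obtain a where a: "a \<in> out_arcs G v" "\<Phi> a > 0"
          by (meson not_le sum_nonpos)
        let ?w = "head G a"
        have w: "?w \<in> verts G" "(v, ?w) \<in> arcs_ends G"
          using a by (auto simp: arcs_ends_conv)
        have "?w = t \<or> sum \<Phi> (out_arcs G ?w) > 0"
        proof (cases "?w = t")
          case False
          have "0 < \<Phi> a" by fact
          also have "\<Phi> a \<le> sum \<Phi> (in_arcs G ?w)"
            by (rule member_le_sum) (use a nonneg in auto)
          also have "\<dots> \<le> sum \<Phi> (out_arcs G ?w)"
            using net[OF w(1) False] by (simp add: net_outflow_def)
          finally show ?thesis by simp
        qed simp
        with 1 w obtain p where "awalk ?w p t" "\<forall>a\<in>set p. \<Phi> a > 0"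
          by blast
        with a show ?thesis
          by (intro exI[of _ "a # p"]) (auto simp: awalk_Cons_iff)
      qed
    qed
  qed
  have "sum \<Phi> (in_arcs G s) \<ge> 0"
    by (rule sum_nonneg) (use nonneg in auto)
  with s have "sum \<Phi> (out_arcs G s) > 0"
    by (simp add: net_outflow_def)
  with * s obtain p where "awalk s p t" "\<forall>a\<in>set p. \<Phi> a > 0"
    by blast
  then show ?thesis
    using acyclic_awalk_imp_apath[OF acyclic] by blast
qed

text \<open>Peel off a positive path with the largest admissible weight. Either the whole value is
  used up and the remainder is a circulation, hence 0, or some arc loses its flow and the support
  shrinks. The value \<open>c\<close> is arbitrary because it drops in the recursion.\<close>

lemma flow_decomposition:
  assumes acyclic: "acyclic (arcs_ends G)"
    and st: "s \<in> verts G" "t \<in> verts G" "s \<noteq> t"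
    and "\<And>a. a \<notin> arcs G \<Longrightarrow> \<Phi> a = 0"
    and "\<And>a. a \<in> arcs G \<Longrightarrow> \<Phi> a \<ge> 0"
    and "\<And>v. v \<in> verts G - {s, t} \<Longrightarrow> net_outflow G \<Phi> v = 0"
    and "net_outflow G \<Phi> s = c" and "c > 0"
  shows "\<exists>x \<in> flow_polytope G s t. \<Phi> = c *\<^sub>R x"
  using assms(5-)
proof (induction "card {a \<in> arcs G. \<Phi> a > 0}" arbitrary: \<Phi> c rule: less_induct)
  case less
  note \<Phi> = less.prems
  define V :: "('b \<Rightarrow> real) set" where "V = {indicator (set p) | p. apath s p t}"
  have FV: "flow_polytope G s t = convex hull V"
    by (simp add: flow_polytope_def V_def)
  have "net_outflow G \<Phi> v \<ge> 0" if "v \<in> verts G" "v \<noteq> t" for v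
    using \<Phi>(3)[of v] \<Phi>(4,5) that by (cases "v = s") auto
  with \<Phi> st obtain p where p: "apath s p t" "\<And>a. a \<in> set p \<Longrightarrow> \<Phi> a > 0"
    using positive_apath[OF acyclic, of \<Phi> t s] by auto
  then have pV: "indicator (set p) \<in> V"
    by (auto simp: V_def)
  have p_arcs: "set p \<subseteq> arcs G" and "p \<noteq> []"
    using p st by (auto simp: apath_def awalk_def)
  \<comment> \<open>The bottleneck of the path, capped by \<open>c\<close> so that the remaining
    value is not negative.\<close>
  define m where "m = min c (Min (\<Phi> ` set p))"
  have "Min (\<Phi> ` set p) \<in> \<Phi> ` set p"
    using \<open>p \<noteq> []\<close> by (intro Min_in) auto
  then have m: "m > 0" "m \<le> c"
    using p \<open>c > 0\<close> by (auto simp: m_def)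
  have m_le: "m \<le> \<Phi> a" if "a \<in> set p" for a
    using that by (auto simp: m_def intro!: min.coboundedI2)
  define \<Psi> where "\<Psi> = \<Phi> - m *\<^sub>R indicator (set p)"
  have \<Psi>0: "\<Psi> a = 0" if "a \<notin> arcs G" for a
    using that p_arcs \<Phi>(1) by (auto simp: \<Psi>_def indicator_def)
  have \<Psi>nn: "\<Psi> a \<ge> 0" if "a \<in> arcs G" for a
    using that \<Phi>(2) m_le by (auto simp: \<Psi>_def indicator_def)
  have net: "net_outflow G \<Psi> v =
      net_outflow G \<Phi> v - m * ((if v = s then 1 else 0) - (if v = t then 1 else 0))" for v
    unfolding \<Psi>_def linear_diff[OF linear_net_outflow] linear_scale[OF linear_net_outflow]
    by (simp add: net_outflow_apath[OF p(1)])
  have \<Psi>v: "net_outflow G \<Psi> v = 0" if "v \<in> verts G - {s, t}" for v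
    using \<Phi>(3)[OF that] that by (simp add: net)
  have \<Psi>s: "net_outflow G \<Psi> s = c - m"
    using \<Phi>(4) st by (simp add: net)
  show ?case
  proof (cases "m = c")
    case True
    \<comment> \<open>All other vertices are balanced, so the zero total forces balance at
      \<open>t\<close> too.\<close>
    have "(\<Sum>v\<in>verts G. net_outflow G \<Psi> v) = (\<Sum>v\<in>{t}. net_outflow G \<Psi> v)"
      using \<Psi>v \<Psi>s True st by (intro sum.mono_neutral_right) auto
    then have "net_outflow G \<Psi> t = 0"
      by (simp add: sum_net_outflow)
    then have "net_outflow G \<Psi> v = 0" if "v \<in> verts G" for v
      using \<Psi>v[of v] \<Psi>s True that by auto
    then have "\<Psi> a = 0" for a
      using circulation_eq_0[OF acyclic, of \<Psi> a] \<Psi>0 \<Psi>nn by blast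
    then have "\<Psi> = 0"
      by auto
    then have "\<Phi> = c *\<^sub>R indicator (set p)"
      by (simp add: \<Psi>_def True)
    with pV show ?thesis
      by (auto simp: FV intro: hull_inc)
  next
    case False
    with m have "m < c" by simp
    then have "m = Min (\<Phi> ` set p)"
      by (auto simp: m_def)
    with \<open>Min (\<Phi> ` set p) \<in> \<Phi> ` set p\<close> obtain a where a: "a \<in> set p" "\<Phi> a = m"
      by auto
    have "{a \<in> arcs G. \<Psi> a > 0} \<subset> {a \<in> arcs G. \<Phi> a > 0}"
    proof (rule psubsetI)
      show "{a \<in> arcs G. \<Psi> a > 0} \<subseteq> {a \<in> arcs G. \<Phi> a > 0}"
        using p(2) by (auto simp: \<Psi>_def indicator_def split: if_splits)
      have "a \<notin> {a \<in> arcs G. \<Psi> a > 0}" "a \<in> {a \<in> arcs G. \<Phi> a > 0}"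
        using a p(2) p_arcs by (auto simp: \<Psi>_def)
      then show "{a \<in> arcs G. \<Psi> a > 0} \<noteq> {a \<in> arcs G. \<Phi> a > 0}" by blast
    qed
    then have "card {a \<in> arcs G. \<Psi> a > 0} < card {a \<in> arcs G. \<Phi> a > 0}"
      by (intro psubset_card_mono) auto
    then obtain x where x: "x \<in> flow_polytope G s t" "\<Psi> = (c - m) *\<^sub>R x"
      using less.hyps[OF _ \<Psi>0 \<Psi>nn \<Psi>v \<Psi>s] \<open>m < c\<close> by auto
    have \<Phi>_eq: "\<Phi> = m *\<^sub>R indicator (set p) + (c - m) *\<^sub>R x"
      using x(2) by (simp add: \<Psi>_def algebra_simps)
    \<comment> \<open>The path and the remainder are averaged in proportion to their values
      \<open>m\<close> and \<open>c - m\<close>.\<close>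
    have "(m / c) *\<^sub>R indicator (set p) + ((c - m) / c) *\<^sub>R x \<in> convex hull V"
      using m \<open>m < c\<close> \<open>c > 0\<close> x(1) pV
      by (intro convexD[OF convex_convex_hull])
        (auto simp: FV diff_divide_distrib intro: hull_inc)
    moreover have "\<Phi> = c *\<^sub>R ((m / c) *\<^sub>R indicator (set p) + ((c - m) / c) *\<^sub>R x)"
      using \<open>c > 0\<close> by (simp add: \<Phi>_eq scaleR_add_right)
    ultimately show ?thesis
      by (auto simp: FV)
  qed
qed

section \<open>Flow polytope and canonical description\<close>

lemma convex_nonneg_flows:
  "convex {\<Phi>. (\<forall>a. a \<notin> arcs G \<longrightarrow> \<Phi> a = 0) \<and>
     (\<forall>v \<in> verts G - {s, t}. net_outflow G \<Phi> v = 0) \<and> net_outflow G \<Phi> s = 1 \<and>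
     (\<forall>a \<in> arcs G. \<Phi> a \<ge> 0)}"
  by (auto simp: convex_def linear_add[OF linear_net_outflow] linear_scale[OF linear_net_outflow])

text \<open>One inclusion is the decomposition at value 1. For the other, convexity reduces the
  claim to path vectors, where \<open>s \<noteq> t\<close> gives net outflow 1 at the
  source.\<close>

theorem solutions_canonical_description_eq_flow_polytope:
  assumes acyclic: "acyclic (arcs_ends G)"
    and st: "s \<in> verts G" "t \<in> verts G" "s \<noteq> t"
  shows "solutions (canonical_description G s t) = flow_polytope G s t"
proof -
  let ?C = "{\<Phi>. (\<forall>a. a \<notin> arcs G \<longrightarrow> \<Phi> a = 0) \<and>
     (\<forall>v \<in> verts G - {s, t}. net_outflow G \<Phi> v = 0) \<and> net_outflow G \<Phi> s = 1 \<and>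
     (\<forall>a \<in> arcs G. \<Phi> a \<ge> 0)}"
  have "solutions (canonical_description G s t) = ?C"
    by (auto simp: solutions_canonical_description net_outflow_def)
  moreover have "?C = flow_polytope G s t"
  proof
    show "?C \<subseteq> flow_polytope G s t"
    proof
      fix \<Phi> assume "\<Phi> \<in> ?C"
      then show "\<Phi> \<in> flow_polytope G s t"
        using flow_decomposition[OF acyclic st, of \<Phi> 1] by auto
    qed
    show "flow_polytope G s t \<subseteq> ?C"
      unfolding flow_polytope_def
    proof (rule hull_minimal)
      have "indicator (set p) a = (0 :: real)" if "apath s p t" "a \<notin> arcs G" for p a
        using that by (auto simp: apath_def awalk_def indicator_def)
      then show "{indicator (set p) | p. apath s p t} \<subseteq> ?C"
        using st by (auto simp: net_outflow_apath split: if_splits)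
    qed (rule convex_nonneg_flows)
  qed
  ultimately show ?thesis by simp
qed

lemma polytope_flow_polytope: "polytope (flow_polytope G s t)"
proof -
  have "finite ((\<lambda>p. indicator (set p) :: 'b \<Rightarrow> real) ` {p. apath s p t})"
    using apaths_finite by simp
  then show ?thesis
    by (auto simp: polytope_def flow_polytope_def setcompr_eq_image)
qed

lemma finite_system_canonical_description: "finite_system (canonical_description G s t)"
  by (simp add: finite_system_def canonical_description_def setcompr_eq_image)

lemma system_size_canonical_description:
  "system_size (canonical_description G s t) = card (arcs G)"
proof -
  \<comment> \<open>The inequalities form a set, so distinct arcs must be seen to give distinct
    coefficient functions.\<close>
  have "inj_on (\<lambda>a. (indicator {a} :: 'b \<Rightarrow> real, 0 :: real)) (arcs G)"
    by (auto simp: inj_on_def fun_eq_iff indicator_def split: if_splits)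
  then show ?thesis
    by (simp add: system_size_def canonical_description_def setcompr_eq_image card_image)
qed

end

section \<open>Nodes and arcs of the semiorder network\<close>

primrec list_order :: "'a list \<Rightarrow> 'a rel" where
  "list_order [] = {}"
| "list_order (x # xs) = {x} \<times> set xs \<union> list_order xs"

lemma list_order_subset: "list_order xs \<subseteq> set xs \<times> set xs"
  by (induction xs) auto

lemma list_order_snoc: "list_order (xs @ [x]) = list_order xs \<union> set xs \<times> {x}"
  by (induction xs) auto

lemma strict_linear_order_on_list_order:
  "distinct xs \<Longrightarrow> strict_linear_order_on (set xs) (list_order xs)"
proof (induction xs)
  case Nil
  then show ?case
    by (simp add: strict_linear_order_on_def irrefl_def)
next
  case (Cons x xs)
  then have IH: "trans (list_order xs)" "irrefl (list_order xs)" "total_on (set xs) (list_order xs)"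
    and "x \<notin> set xs"
    by (simp_all add: strict_linear_order_on_def)
  have "trans (list_order (x # xs))"
  proof (rule transI)
    fix a b c assume ab: "(a, b) \<in> list_order (x # xs)" and bc: "(b, c) \<in> list_order (x # xs)"
    have "b \<in> set xs"
      using ab list_order_subset[of xs] by auto
    with bc \<open>x \<notin> set xs\<close> have "(b, c) \<in> list_order xs"
      by auto
    with ab show "(a, c) \<in> list_order (x # xs)"
      using list_order_subset[of xs] transD[OF IH(1)] by auto
  qed
  moreover have "irrefl (list_order (x # xs))"
    using IH(2) \<open>x \<notin> set xs\<close> by (auto simp: irrefl_def)
  moreover have "total_on (set (x # xs)) (list_order (x # xs))"
    using IH(3) by (auto simp: total_on_def)
  ultimately show ?case
    by (simp add: strict_linear_order_on_def)
qed

text \<open>A minimal element is first by totality; it becomes the head of the list, and induction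
  handles the rest.\<close>

lemma strict_linear_order_on_eq_list_order:
  assumes "finite A" and "strict_linear_order_on A L" and "L \<subseteq> A \<times> A"
  shows "\<exists>xs. distinct xs \<and> set xs = A \<and> L = list_order xs"
  using assms
proof (induction A arbitrary: L rule: finite_psubset_induct)
  case (psubset A)
  show ?case
  proof (cases "A = {}")
    case True
    with psubset.prems show ?thesis
      by (intro exI[of _ "[]"]) auto
  next
    case False
    have "trans L" "irrefl L" "total_on A L"
      using psubset.prems by (auto simp: strict_linear_order_on_def)
    then have "acyclic L"
      by (simp add: acyclic_irrefl)
    moreover have "finite L"
      using psubset.prems(2) by (rule finite_subset) (use psubset.hyps in simp)
    ultimately have "wf L"
      by (rule finite_acyclic_wf[rotated])
    then obtain m where m: "m \<in> A" "\<And>k. (k, m) \<in> L \<Longrightarrow> k \<notin> A"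
      using False by (metis ex_in_conv wfE_min)
    define L' where "L' = L \<inter> (A - {m}) \<times> (A - {m})"
    have "trans L'"
      using \<open>trans L\<close> unfolding L'_def trans_def by blast
    then have "strict_linear_order_on (A - {m}) L'"
      using \<open>irrefl L\<close> \<open>total_on A L\<close>
      unfolding strict_linear_order_on_def L'_def irrefl_def total_on_def by blast
    then obtain xs where xs: "distinct xs" "set xs = A - {m}" "L' = list_order xs"
      using psubset.IH[of "A - {m}" L'] m by (auto simp: L'_def)
    have "(m, k) \<in> L" if "k \<in> A - {m}" for k
      using \<open>total_on A L\<close> m that by (auto simp: total_on_def)
    moreover have "(m, m) \<notin> L"
      using \<open>irrefl L\<close> by (simp add: irrefl_def)
    \<comment> \<open>Minimality excludes pairs ending in \<open>m\<close>, so besides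
      \<open>L'\<close> only pairs starting in \<open>m\<close> remain.\<close>
    ultimately have "L = {m} \<times> (A - {m}) \<union> L'"
      using psubset.prems(2) m unfolding L'_def by blast
    then have "L = list_order (m # xs)"
      using xs by simp
    with xs(1,2) m(1) show ?thesis
      by (intro exI[of _ "m # xs"]) auto
  qed
qed

section \<open>Nodes and arcs in queue form\<close>

definition queue_node :: "'a set \<Rightarrow> 'a list \<Rightarrow> 'a so_node" where
  "queue_node Y xs = (Y \<union> set xs, Y, list_order xs)"

lemma queue_node_in_so_nodes:
  assumes "distinct xs" and "Y \<inter> set xs = {}" and "Y \<union> set xs \<subseteq> S"
  shows "queue_node Y xs \<in> so_nodes S"
proof -
  have "Y \<union> set xs - Y = set xs"
    using assms by auto
  then show ?thesis
    using assms list_order_subset[of xs] strict_linear_order_on_list_order[of xs]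
    by (auto simp: so_nodes_def queue_node_def)
qed

text \<open>Trades the strict order in a node for a list, on which opening appends and closing
  removes the head.\<close>

lemma so_nodeE:
  assumes "finite S" and "v \<in> so_nodes S"
  obtains Y xs where "distinct xs" "Y \<inter> set xs = {}" "Y \<union> set xs \<subseteq> S" "v = queue_node Y xs"
proof -
  obtain X Y L where v: "v = (X, Y, L)" "Y \<subseteq> X" "X \<subseteq> S"
      "L \<subseteq> (X - Y) \<times> (X - Y)" "strict_linear_order_on (X - Y) L"
    using assms by (auto simp: so_nodes_def)
  have "finite (X - Y)"
    using v assms by (meson finite_Diff finite_subset)
  then obtain xs where "distinct xs" "set xs = X - Y" "L = list_order xs"
    using strict_linear_order_on_eq_list_order[OF _ v(5,4)] by blast
  with v show ?thesis
    by (intro that[of xs Y]) (auto simp: queue_node_def)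
qed

lemma open_arc_in_arcs:
  assumes "distinct (xs @ [x])" and "Y \<inter> set (xs @ [x]) = {}" and "Y \<union> set (xs @ [x]) \<subseteq> S"
  shows "(queue_node Y xs, queue_node Y (xs @ [x])) \<in> arcs (so_network S)"
proof -
  have "Y \<union> set xs - Y = set xs"
    using assms by auto
  then have "so_open S (queue_node Y xs) (queue_node Y (xs @ [x]))"
    using assms by (auto simp: so_open_def queue_node_def list_order_snoc)
  then show ?thesis
    using assms queue_node_in_so_nodes[of xs Y S] queue_node_in_so_nodes[of "xs @ [x]" Y S]
    by (auto simp: so_network_def)
qed

lemma close_arc_in_arcs:
  assumes "distinct (x # xs)" and "Y \<inter> set (x # xs) = {}" and "Y \<union> set (x # xs) \<subseteq> S"
  shows "(queue_node Y (x # xs), queue_node (insert x Y) xs) \<in> arcs (so_network S)"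
proof -
  have "Y \<union> set (x # xs) - Y = set (x # xs)"
    using assms by auto
  moreover have "list_order xs = list_order (x # xs) \<inter> set xs \<times> set xs"
    using assms list_order_subset[of xs] by auto
  ultimately have "so_close (queue_node Y (x # xs)) (queue_node (insert x Y) xs)"
    using assms by (simp add: so_close_def queue_node_def)
  then show ?thesis
    using assms queue_node_in_so_nodes[of "x # xs" Y S] queue_node_in_so_nodes[of xs "insert x Y" S]
    by (auto simp: so_network_def)
qed

text \<open>Both kinds of arcs are indexed by a set \<open>Y\<close> and a nonempty queue
  \<open>xs\<close>: the queue after an opening, or before a closing. The arc count rests on this
  common index set.\<close>

lemma so_network_arcE:
  assumes "finite S" and "a \<in> arcs (so_network S)"
  obtains Y xs where "Y \<subseteq> S" "distinct xs" "set xs \<subseteq> S - Y" "xs \<noteq> []"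
    and "a = (queue_node Y (butlast xs), queue_node Y xs) \<or>
      a = (queue_node Y xs, queue_node (insert (hd xs) Y) (tl xs))"
proof -
  obtain u v where a: "a = (u, v)" "u \<in> so_nodes S" "so_open S u v \<or> so_close u v"
    using assms by (auto simp: so_network_def)
  obtain Y xs where u: "distinct xs" "Y \<inter> set xs = {}" "Y \<union> set xs \<subseteq> S" "u = queue_node Y xs"
    using so_nodeE[OF assms(1) a(2)] .
  have diff: "Y \<union> set xs - Y = set xs"
    using u by auto
  show ?thesis
    using a(3)
  proof
    assume "so_open S u v"
    then obtain i where "i \<in> S - (Y \<union> set xs)" "v = queue_node Y (xs @ [i])"
      using diff by (auto simp: so_open_def u queue_node_def list_order_snoc)
    with u a(1) show ?thesis
      by (intro that[of Y "xs @ [i]"]) auto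
  next
    assume "so_close u v"
    then obtain j where j: "j \<in> set xs" "\<forall>k \<in> set xs - {j}. (j, k) \<in> list_order xs"
        "v = (Y \<union> set xs, Y \<union> {j}, list_order xs \<inter> (set xs - {j}) \<times> (set xs - {j}))"
      using diff by (auto simp: so_close_def u queue_node_def)
    then obtain x ys where xs: "xs = x # ys"
      by (cases xs) auto
    have "x \<notin> set ys"
      using u(1) xs by simp
    \<comment> \<open>\<open>so_close\<close> only makes \<open>j\<close> first in the order; since
      nothing precedes the head \<open>x\<close>, \<open>j\<close> must be the head.\<close>
    have "j = x"
    proof (rule ccontr)
      assume "j \<noteq> x"
      then have "(j, x) \<in> list_order ys"
        using j(2) xs by auto
      with \<open>x \<notin> set ys\<close> show False
        using list_order_subset[of ys] by auto
    qed
    moreover have "list_order xs \<inter> set ys \<times> set ys = list_order ys"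
      using xs \<open>x \<notin> set ys\<close> list_order_subset[of ys] by auto
    ultimately have "v = queue_node (insert x Y) ys"
      using j(3) xs \<open>x \<notin> set ys\<close> by (simp add: queue_node_def)
    with u a(1) xs show ?thesis
      by (intro that[of Y xs]) auto
  qed
qed

section \<open>From paths to semiorders\<close>

text \<open>The summation set of \<open>so_projection\<close> without the arc condition, which
  intersecting with the arcs of a walk restores.\<close>

definition closed_before :: "'a \<Rightarrow> 'a \<Rightarrow> ('a so_node \<times> 'a so_node) set" where
  "closed_before i j = {((X, Y, L), (Z, T, M)). i \<in> Y \<and> j \<in> Z - X}"

text \<open>Turns the projection of a path vector into a count that can be followed arc by arc along
  a walk.\<close>

lemma so_projection_indicator:
  assumes "finite S" and "set p \<subseteq> arcs (so_network S)"
  shows "so_projection S (indicator (set p)) (i, j) =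
    (if i \<in> S \<and> j \<in> S \<and> i \<noteq> j then real (card (set p \<inter> closed_before i j)) else 0)"
proof -
  have "finite (arcs (so_network S))"
    using digraph_so_network[OF assms(1)] by (simp add: digraph_def fin_digraph.finite_arcs)
  moreover have "{((X, Y, L), (Z, T, M)) \<in> arcs (so_network S). i \<in> Y \<and> j \<in> Z - X} =
      arcs (so_network S) \<inter> closed_before i j"
    by (auto simp: closed_before_def)
  moreover have "set p \<inter> closed_before i j = {a \<in> arcs (so_network S) \<inter> closed_before i j. a \<in> set p}"
    using assms by auto
  ultimately have "sum (indicator (set p)) {((X, Y, L), (Z, T, M)) \<in> arcs (so_network S). i \<in> Y \<and> j \<in> Z - X} =
      real (card (set p \<inter> closed_before i j))"
    by (simp add: indicator_def sum_of_bool_eq Int_def)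
  then show ?thesis
    by (simp only: so_projection_def prod.case)
qed

text \<open>
  Time runs along a walk: \<open>T\<close> is the current time, \<open>l i\<close> the time at which \<open>i\<close> was opened, and \<open>i\<close>
  is closed at time \<open>l i + 1\<close>.
\<close>

definition realizes_node :: "('a \<Rightarrow> real) \<Rightarrow> real \<Rightarrow> 'a so_node \<Rightarrow> bool" where
  "realizes_node l T = (\<lambda>(X, Y, L). (\<forall>i\<in>X. l i \<le> T) \<and> (\<forall>i\<in>Y. l i + 1 \<le> T) \<and>
     (\<forall>i\<in>X - Y. T < l i + 1) \<and> (\<forall>(i, j)\<in>L. l i < l j))"

text \<open>
  Since the queue is first in, first out, equal lifetimes never contradict the order of the closing
  events; an opening can always be squeezed in before the next closing.
\<close>

lemma awalk_unit_interval_representation: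
  assumes "finite S" and "pre_digraph.awalk (so_network S) so_source p (X, Y, L)"
  shows "\<exists>l T. realizes_node l T (X, Y, L) \<and>
    (\<forall>i j. card (set p \<inter> closed_before i j) = (if i \<in> X \<and> j \<in> X \<and> l i + 1 < l j then 1 else 0))"
proof -
  interpret digraph "so_network S"
    by (rule digraph_so_network) fact
  show ?thesis
    using assms(2)
  \<comment> \<open>The last arc extends a schedule that is already timed up to its tail.\<close>
  proof (induction p arbitrary: X Y L rule: rev_induct)
    case Nil
    then show ?case
      by (simp add: awalk_Nil_iff so_source_def realizes_node_def)
  next
    case (snoc a p)
    obtain X0 Y0 L0 where u: "tail (so_network S) a = (X0, Y0, L0)"
      by (cases "tail (so_network S) a") auto
    have walk: "awalk so_source p (X0, Y0, L0)" and a: "a \<in> arcs (so_network S)"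
        "head (so_network S) a = (X, Y, L)"
      using snoc.prems u by (auto simp: awalk_simps)
    have a_eq: "a = ((X0, Y0, L0), (X, Y, L))"
      using u a(2) by (cases a) (simp add: so_network_def)
    have node: "Y0 \<subseteq> X0" "X0 \<subseteq> S" "L0 \<subseteq> (X0 - Y0) \<times> (X0 - Y0)"
      using a by (auto simp: so_network_def so_nodes_def a_eq)
    have "finite X0"
      using node assms(1) by (meson finite_subset)
    obtain l T where "realizes_node l T (X0, Y0, L0)"
      and card: "\<And>i j. card (set p \<inter> closed_before i j) =
          (if i \<in> X0 \<and> j \<in> X0 \<and> l i + 1 < l j then 1 else 0)"
      using snoc.IH[OF walk] by blast
    then have l: "\<forall>i\<in>X0. l i \<le> T" "\<forall>i\<in>Y0. l i + 1 \<le> T" "\<forall>i\<in>X0 - Y0. T < l i + 1"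
        "\<forall>(i, j)\<in>L0. l i < l j"
      by (simp_all add: realizes_node_def)
    have "so_open S (X0, Y0, L0) (X, Y, L) \<or> so_close (X0, Y0, L0) (X, Y, L)"
      using a by (simp add: so_network_def a_eq)
    then show ?case
    proof
      assume "so_open S (X0, Y0, L0) (X, Y, L)"
      then obtain k where k: "k \<in> S - X0" "X = X0 \<union> {k}" "Y = Y0" "L = L0 \<union> (X0 - Y0) \<times> {k}"
        by (auto simp: so_open_def)
      \<comment> \<open>The next closing time; \<open>T + 1\<close> is a default that also covers
        the empty queue. The new opening is placed strictly between \<open>T\<close> and
        \<open>m\<close>.\<close>
      define m where "m = Min (insert (T + 1) ((\<lambda>i. l i + 1) ` (X0 - Y0)))"
      have "T < m"
        using l(3) \<open>finite X0\<close> by (simp add: m_def)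
      then obtain T' where "T < T'" "T' < m"
        using dense by blast
      then have T': "T < T'" "\<And>i. i \<in> X0 - Y0 \<Longrightarrow> T' < l i + 1"
        using \<open>finite X0\<close> by (auto simp: m_def)
      define l' where "l' = l(k := T')"
      have l'[simp]: "l' k = T'" "\<And>i. i \<in> X0 \<Longrightarrow> l' i = l i"
        using k by (auto simp: l'_def)
      have "card (set (p @ [a]) \<inter> closed_before i j) =
          (if i \<in> X \<and> j \<in> X \<and> l' i + 1 < l' j then 1 else 0)" for i j
      proof (cases "j = k")
        case True
        have "card (set p \<inter> closed_before i k) = 0"
          using card k by auto
        then have "set p \<inter> closed_before i k = {}"
          by simp
        then have "set (p @ [a]) \<inter> closed_before i k = (if i \<in> Y0 then {a} else {})"
          using k by (auto simp: closed_before_def a_eq)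
        \<comment> \<open>Closed elements end by \<open>T\<close>, hence strictly before
          \<open>T'\<close>; queued ones end after \<open>T'\<close>, and so does \<open>k\<close>
          itself.\<close>
        moreover have "i \<in> Y0 \<longleftrightarrow> i \<in> X \<and> l' i + 1 < T'"
          using l(2) T' node k by force
        ultimately show ?thesis
          using True k by auto
      next
        case False
        then have "a \<notin> closed_before i j"
          using k by (auto simp: closed_before_def a_eq)
        then have "set (p @ [a]) \<inter> closed_before i j = set p \<inter> closed_before i j"
          by auto
        \<comment> \<open>All earlier elements were opened by time \<open>T\<close>, so the new
          interval precedes none of them.\<close>
        moreover have "\<not> l' k + 1 < l' j" if "j \<in> X0"
          using l(1) that T' by force
        ultimately show ?thesis
          using card[of i j] k False by auto
      qed
      moreover have "\<forall>i\<in>X. l' i \<le> T'" "\<forall>i\<in>Y. l' i + 1 \<le> T'" "\<forall>i\<in>X - Y. T' < l' i + 1"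
        using l T' k node by force+
      moreover have "\<forall>(i, j)\<in>L. l' i < l' j"
        using l T' k node by (force simp: l'_def)
      ultimately show ?thesis
        by (intro exI[of _ l'] exI[of _ T']) (simp add: realizes_node_def)
    next
      assume "so_close (X0, Y0, L0) (X, Y, L)"
      then obtain k where k: "k \<in> X0 - Y0" "\<forall>i \<in> X0 - Y0 - {k}. (k, i) \<in> L0"
          "X = X0" "Y = Y0 \<union> {k}" "L \<subseteq> L0"
        by (auto simp: so_close_def)
      \<comment> \<open>A closing arc opens nothing, so it adds nothing to the counts.\<close>
      have "set (p @ [a]) \<inter> closed_before i j = set p \<inter> closed_before i j" for i j
        using k by (auto simp: closed_before_def a_eq)
      then have "\<forall>i j. card (set (p @ [a]) \<inter> closed_before i j) =
          (if i \<in> X \<and> j \<in> X \<and> l i + 1 < l j then 1 else 0)"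
        using card k by simp
      moreover have T: "T < l k + 1"
        using l(3) k(1) by auto
      have "\<forall>i\<in>X. l i \<le> l k + 1"
        using l(1) k(3) T by (meson less_imp_le order_trans)
      moreover have "\<forall>i\<in>Y. l i + 1 \<le> l k + 1"
        using l(2) k(4) T by (metis UnE less_imp_le order_refl order_trans singletonD)
      \<comment> \<open>The clock has moved to the end of \<open>k\<close>. As \<open>k\<close>
        heads the queue and opening times increase along it, every other open element ends
        later.\<close>
      moreover have "\<forall>i\<in>X - Y. l k + 1 < l i + 1"
        using l k by auto
      moreover have "\<forall>(i, j)\<in>L. l i < l j"
        using l k by auto
      ultimately show ?thesis
        by (intro exI[of _ l] exI[of _ "l k + 1"]) (simp add: realizes_node_def)
    qed
  qed
qed

text \<open>At the sink every element has been opened, so the opening times with common length 1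
  represent a semiorder whose entries are the counts.\<close>

lemma so_projection_awalk:
  assumes "finite S" and "pre_digraph.awalk (so_network S) so_source p (so_sink S)"
  shows "\<exists>R. semiorder_on S R \<and> so_projection S (indicator (set p)) = indicator R"
proof -
  obtain l :: "'a \<Rightarrow> real" where
    l: "\<And>i j. card (set p \<inter> closed_before i j) = (if i \<in> S \<and> j \<in> S \<and> l i + 1 < l j then 1 else 0)"
    using awalk_unit_interval_representation[OF assms[unfolded so_sink_def]] by metis
  have p: "set p \<subseteq> arcs (so_network S)"
    using assms by (simp add: pre_digraph.awalk_def)
  define R where "R = {(i, j). i \<in> S \<and> j \<in> S \<and> l i + 1 < l j}"
  have "semiorder_on S R"
    unfolding semiorder_on_def
    by (intro conjI exI[of _ l] exI[of _ "\<lambda>i. l i + 1"] exI[of _ 1]) (auto simp: R_def)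
  moreover have "so_projection S (indicator (set p)) (i, j) = indicator R (i, j)" for i j
    using l[of i j] by (auto simp: so_projection_indicator[OF assms(1) p] R_def)
  then have "so_projection S (indicator (set p)) = indicator R"
    by auto
  ultimately show ?thesis
    by blast
qed

section \<open>From semiorders to paths\<close>

text \<open>
  The greedy sweep along the real line: the first interval in the queue is closed as soon as it
  ends strictly before the next interval begins.
\<close>

lemma exists_awalk_of_interval_order:
  fixes l :: "'a \<Rightarrow> real"
  assumes "finite S" and "r \<ge> 0"
    and "distinct (xs @ zs)" and "Y \<inter> set (xs @ zs) = {}" and "Y \<union> set (xs @ zs) = S"
    and "sorted (map l (xs @ zs))"
    and "\<And>y z. y \<in> Y \<Longrightarrow> z \<in> set zs \<Longrightarrow> l y + r < l z"
  shows "\<exists>p. pre_digraph.awalk (so_network S) (queue_node Y xs) p (so_sink S) \<and>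
    (\<forall>i j. card (set p \<inter> closed_before i j) = (if i \<in> S \<and> j \<in> set zs \<and> l i + r < l j then 1 else 0))"
proof -
  interpret digraph "so_network S"
    by (rule digraph_so_network) fact
  have [simp]: "tail (so_network S) = fst" "head (so_network S) = snd"
    by (simp_all add: so_network_def)
  show ?thesis
    using assms(3-)
  \<comment> \<open>A waiting element weighs 2 and a queued one 1, so opening and closing both lower
    the measure.\<close>
  proof (induction "2 * length zs + length xs" arbitrary: xs zs Y rule: less_induct)
    case less
    note prems = less.prems
    \<comment> \<open>Closing the head preserves the invariant that closed elements end before all
      waiting ones begin, provided that the head does so too.\<close>
    have close: ?case if xs: "xs = x # xs'" and lx: "\<And>z. z \<in> set zs \<Longrightarrow> l x + r < l z" for x xs'
    proof -
      obtain p where p: "awalk (queue_node (insert x Y) xs') p (so_sink S)"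
        "\<And>i j. card (set p \<inter> closed_before i j) =
            (if i \<in> S \<and> j \<in> set zs \<and> l i + r < l j then 1 else 0)"
        using less.hyps[of zs xs' "insert x Y"] prems xs lx by auto
      let ?a = "(queue_node Y (x # xs'), queue_node (insert x Y) xs')"
      have "set (?a # p) \<inter> closed_before i j = set p \<inter> closed_before i j" for i j
        by (auto simp: closed_before_def queue_node_def)
      moreover have "?a \<in> arcs (so_network S)"
        using prems xs by (intro close_arc_in_arcs) auto
      ultimately show ?thesis
        using p xs by (intro exI[of _ "?a # p"]) (simp add: awalk_Cons_iff)
    qed
    show ?case
    proof (cases zs)
      case Nil
      show ?thesis
      proof (cases xs)
        case xs: Nil
        have "so_sink S \<in> verts (so_network S)"
          using queue_node_in_so_nodes[of "[]" S S]
          by (simp add: so_sink_def queue_node_def so_network_def)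
        with Nil xs prems show ?thesis
          by (intro exI[of _ "[]"]) (simp add: awalk_Nil_iff queue_node_def so_sink_def)
      next
        case (Cons x xs')
        with Nil show ?thesis
          by (intro close) auto
      qed
    next
      case (Cons z zs')
      show ?thesis
      proof (cases "xs \<noteq> [] \<and> l (hd xs) + r < l z")
        case True
        with prems Cons show ?thesis
          by (intro close[of "hd xs" "tl xs"]) (auto simp: sorted_append)
      next
        case False
        \<comment> \<open>The head has not ended before \<open>z\<close> begins; the queue is sorted
          by \<open>l\<close>, so no queued element has.\<close>
        have ge: "l z \<le> l i + r" if i: "i \<in> set xs" for i
        proof -
          obtain x xs' where xs: "xs = x # xs'"
            using i by (cases xs) auto
          then have "l z \<le> l x + r" "l x \<le> l i"
            using False i prems by auto
          then show ?thesis by simp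
        qed
        have ge': "l z \<le> l i + r" if "i \<in> set zs" for i
          using that prems Cons \<open>r \<ge> 0\<close> by (auto simp: sorted_append)
        obtain p where p: "awalk (queue_node Y (xs @ [z])) p (so_sink S)"
          "\<And>i j. card (set p \<inter> closed_before i j) =
              (if i \<in> S \<and> j \<in> set zs' \<and> l i + r < l j then 1 else 0)"
          using less.hyps[of zs' "xs @ [z]" Y] prems Cons by auto
        let ?a = "(queue_node Y xs, queue_node Y (xs @ [z]))"
        have a: "?a \<in> arcs (so_network S)"
          using prems Cons by (intro open_arc_in_arcs) auto
        have "card (set (?a # p) \<inter> closed_before i j) =
            (if i \<in> S \<and> j \<in> set zs \<and> l i + r < l j then 1 else 0)" for i j
        proof (cases "j = z")
          case True
          have "z \<notin> set zs'" "z \<notin> Y \<union> set xs"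
            using prems Cons by auto
          then have "card (set p \<inter> closed_before i z) = 0"
            using p(2)[of i z] by simp
          then have "set p \<inter> closed_before i z = {}"
            by simp
          then have "set (?a # p) \<inter> closed_before i z = (if i \<in> Y then {?a} else {})"
            using \<open>z \<notin> Y \<union> set xs\<close> by (auto simp: closed_before_def queue_node_def)
          \<comment> \<open>The invariant gives one direction. Conversely, elements of
            \<open>xs\<close> and \<open>zs\<close> do not end before \<open>z\<close> begins, and
            \<open>Y\<close>, \<open>xs\<close>, \<open>zs\<close> exhaust \<open>S\<close>.\<close>
          moreover have "i \<in> Y \<longleftrightarrow> i \<in> S \<and> l i + r < l z"
            using prems(3,5) ge[of i] ge'[of i] Cons by auto
          ultimately show ?thesis
            using True Cons by auto
        next
          case False
          then have "set (?a # p) \<inter> closed_before i j = set p \<inter> closed_before i j"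
            by (auto simp: closed_before_def queue_node_def)
          then show ?thesis
            using p(2)[of i j] False Cons by simp
        qed
        then show ?thesis
          using a p(1) by (intro exI[of _ "?a # p"]) (simp add: awalk_Cons_iff)
      qed
    qed
  qed
qed

lemma exists_awalk_of_semiorder:
  assumes "finite S" and "semiorder_on S R"
  shows "\<exists>p. pre_digraph.awalk (so_network S) so_source p (so_sink S) \<and>
    so_projection S (indicator (set p)) = indicator R"
proof -
  obtain l h :: "'a \<Rightarrow> real" and r :: real where "R \<subseteq> S \<times> S" "r \<ge> 0"
    and "\<And>i j. i \<in> S \<Longrightarrow> j \<in> S \<Longrightarrow> h i - l i = r \<and> ((i, j) \<in> R \<longleftrightarrow> h i < l j)"
    using assms(2) unfolding semiorder_on_def by blast
  \<comment> \<open>The right endpoints are eliminated: on \<open>S\<close>, \<open>h\<close> is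
    \<open>l\<close> shifted by \<open>r\<close>.\<close>
  then have R: "(i, j) \<in> R \<longleftrightarrow> i \<in> S \<and> j \<in> S \<and> l i + r < l j" for i j
    by (smt (verit) SigmaE2 subsetD)
  obtain zs0 where "set zs0 = S" "distinct zs0"
    using finite_distinct_list[OF assms(1)] by blast
  then obtain zs where zs: "set zs = S" "distinct zs" "sorted (map l zs)"
    using set_sort[of l zs0] distinct_sort[of l zs0] sorted_sort_key[of l zs0] by metis
  then obtain p where p: "pre_digraph.awalk (so_network S) so_source p (so_sink S)"
    and card: "\<And>i j. card (set p \<inter> closed_before i j) =
      (if i \<in> S \<and> j \<in> S \<and> l i + r < l j then 1 else 0)"
    using exists_awalk_of_interval_order[of S r "[]" zs "{}" l] assms(1) \<open>r \<ge> 0\<close>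
    by (auto simp: queue_node_def so_source_def)
  have "set p \<subseteq> arcs (so_network S)"
    using p by (simp add: pre_digraph.awalk_def)
  \<comment> \<open>On the diagonal the projection is 0 by definition, and \<open>r \<ge> 0\<close>
    keeps \<open>R\<close> irreflexive.\<close>
  then have "so_projection S (indicator (set p)) (i, j) = indicator R (i, j)" for i j
    using card[of i j] R \<open>r \<ge> 0\<close> by (auto simp: so_projection_indicator[OF assms(1)] indicator_def)
  then have "so_projection S (indicator (set p)) = indicator R"
    by auto
  with p show ?thesis
    by auto
qed

section \<open>The number of arcs\<close>

text \<open>With n elements there are n!/(n-k)! distinct lists of length k, to be summed over k from
  1 to n.\<close>

lemma card_distinct_lists:
  assumes "finite A"
  shows "real (card {xs. distinct xs \<and> set xs \<subseteq> A \<and> xs \<noteq> []}) =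
    fact (card A) * (\<Sum>k<card A. 1 / fact k)"
proof -
  let ?B = "\<lambda>k. {xs. length xs = k \<and> distinct xs \<and> set xs \<subseteq> A}"
  have finB: "finite (?B k)" for k
    by (rule finite_subset[OF _ finite_lists_length_eq[OF assms, of k]]) auto
  have cardB: "real (card (?B k)) = fact (card A) / fact (card A - k)" if "k \<le> card A" for k
  proof -
    have "fact (card A) = fact (card A - k) * \<Prod>{card A - k + 1..card A}"
      using fact_eq_fact_times[of "card A - k" "card A"] by simp
    then have "(fact (card A) :: real) = fact (card A - k) * real (\<Prod>{card A - k + 1..card A})"
      by (metis of_nat_fact of_nat_mult)
    with card_lists_distinct_length_eq[OF assms that] show ?thesis
      by (simp add: field_simps)
  qed
  have "{xs. distinct xs \<and> set xs \<subseteq> A \<and> xs \<noteq> []} = (\<Union>k\<in>{1..card A}. ?B k)"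
  proof (intro set_eqI iffI)
    fix xs assume xs: "xs \<in> {xs. distinct xs \<and> set xs \<subseteq> A \<and> xs \<noteq> []}"
    then have "length xs = card (set xs)"
      by (simp add: distinct_card)
    also have "\<dots> \<le> card A"
      using xs assms by (simp add: card_mono)
    finally show "xs \<in> (\<Union>k\<in>{1..card A}. ?B k)"
      using xs by (cases xs) auto
  qed auto
  then have "real (card {xs. distinct xs \<and> set xs \<subseteq> A \<and> xs \<noteq> []}) = (\<Sum>k\<in>{1..card A}. real (card (?B k)))"
    using finB by (simp add: card_UN_disjoint disjoint_iff)
  also have "\<dots> = (\<Sum>k\<in>{1..card A}. fact (card A) / fact (card A - k))"
    using cardB by simp
  also have "\<dots> = (\<Sum>k<card A. fact (card A) / fact k)"
    \<comment> \<open>Replacing k by n - k turns the range 1..n into 0..n-1; omitting the empty list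
      is what removes the term 1/n!.\<close>
    by (rule sum.reindex_bij_witness[of _ "\<lambda>k. card A - k" "\<lambda>k. card A - k"]) auto
  finally show ?thesis
    by (simp add: sum_distrib_left)
qed

lemma sum_Pow_card:
  assumes "finite A"
  shows "(\<Sum>B\<in>Pow A. f (card B)) = (\<Sum>k\<le>card A. of_nat (card A choose k) * (f k :: real))"
proof -
  have "(\<Sum>B\<in>Pow A. f (card B)) = (\<Sum>k\<le>card A. \<Sum>B\<in>{B \<in> Pow A. card B = k}. f (card B))"
    using assms by (intro sum.group[symmetric]) (auto intro: card_mono)
  also have "\<dots> = (\<Sum>k\<le>card A. of_nat (card A choose k) * f k)"
    using n_subsets[OF assms] by (intro sum.cong) (auto simp: Pow_def)
  finally show ?thesis .
qed

lemma card_arcs_so_network_le: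
  assumes "finite S"
  shows "real (card (arcs (so_network S))) \<le> 2 * fact (card S) * (\<Sum>k<card S. 1 / fact k)\<^sup>2"
proof -
  let ?n = "card S"
  let ?e = "\<Sum>k<?n. 1 / fact k :: real"
  let ?lists = "\<lambda>Y. {xs. distinct xs \<and> set xs \<subseteq> S - Y \<and> xs \<noteq> []}"
  define B where "B = (SIGMA Y:Pow S. ?lists Y)"
  have fin: "finite (?lists Y)" for Y
    using finite_subset_distinct[of "S - Y"] assms by (rule_tac finite_subset) auto
  then have "finite B"
    unfolding B_def using assms by (intro finite_SigmaI) auto
  define f where "f = (\<lambda>(Y, xs :: 'a list). (queue_node Y (butlast xs), queue_node Y xs))"
  define g where
    "g = (\<lambda>(Y, xs :: 'a list). (queue_node Y xs, queue_node (insert (hd xs) Y) (tl xs)))"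
  have "arcs (so_network S) \<subseteq> f ` B \<union> g ` B"
  proof
    fix a assume "a \<in> arcs (so_network S)"
    then obtain Y xs where "Y \<subseteq> S" "distinct xs" "set xs \<subseteq> S - Y" "xs \<noteq> []"
      and a: "a = f (Y, xs) \<or> a = g (Y, xs)"
      using so_network_arcE[OF assms] unfolding f_def g_def prod.case by metis
    then have "(Y, xs) \<in> B"
      by (simp add: B_def)
    with a show "a \<in> f ` B \<union> g ` B"
      by blast
  qed
  then have "card (arcs (so_network S)) \<le> card (f ` B \<union> g ` B)"
    using \<open>finite B\<close> by (intro card_mono) auto
  also have "\<dots> \<le> card (f ` B) + card (g ` B)"
    by (rule card_Un_le)
  also have "\<dots> \<le> card B + card B"
    using \<open>finite B\<close> by (intro add_mono card_image_le)
  finally have "card (arcs (so_network S)) \<le> card B + card B" .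
  moreover have "real (card B) \<le> fact ?n * ?e\<^sup>2"
  proof -
    have "real (card B) = (\<Sum>Y\<in>Pow S. real (card (?lists Y)))"
      using assms fin by (simp add: B_def)
    also have "\<dots> = (\<Sum>Y\<in>Pow S. fact (?n - card Y) * (\<Sum>k<?n - card Y. 1 / fact k))"
      using assms by (intro sum.cong)
        (auto simp: card_distinct_lists card_Diff_subset finite_subset)
    also have "\<dots> = (\<Sum>k\<le>?n. of_nat (?n choose k) * (fact (?n - k) * (\<Sum>i<?n - k. 1 / fact i)))"
      by (rule sum_Pow_card[OF assms])
    also have "\<dots> = (\<Sum>k\<le>?n. fact ?n / fact k * (\<Sum>i<?n - k. 1 / fact i))"
      by (intro sum.cong) (auto simp: binomial_fact)
    \<comment> \<open>The term with k = n vanishes because its inner sum is empty.\<close>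
    also have "\<dots> = (\<Sum>k<?n. fact ?n / fact k * (\<Sum>i<?n - k. 1 / fact i))"
      by (simp flip: lessThan_Suc_atMost)
    \<comment> \<open>Extending the inner sum to its full range decouples the double sum into a
      square.\<close>
    also have "\<dots> \<le> (\<Sum>k<?n. fact ?n / fact k * ?e)"
      by (intro sum_mono mult_left_mono sum_mono2) auto
    also have "\<dots> = fact ?n * ?e\<^sup>2"
    proof -
      have "fact ?n * ?e = (\<Sum>k<?n. fact ?n / fact k)"
        by (simp add: sum_distrib_left)
      then have "fact ?n * ?e * ?e = (\<Sum>k<?n. fact ?n / fact k * ?e)"
        by (simp only: sum_distrib_right)
      then show ?thesis
        by (simp add: power2_eq_square mult.assoc)
    qed
    finally show ?thesis .
  qed
  ultimately show ?thesis
    by linarith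
qed

lemma sum_inverse_fact_le_exp: "(\<Sum>k<n. 1 / fact k) \<le> exp (1 :: real)"
proof -
  have "(\<lambda>k. 1 / fact k :: real) sums exp 1"
    using exp_converges[of "1 :: real"] by (simp add: divide_inverse)
  then show ?thesis
    using sum_le_suminf[of "\<lambda>k. 1 / fact k :: real" "{..<n}"] by (simp add: sums_iff)
qed

lemma card_arcs_so_network_le_exp:
  assumes "finite S" and "card S \<ge> 1"
  shows "real (card (arcs (so_network S))) \<le> (exp 1)\<^sup>2 * real (card S) * fact (card S)"
proof (cases "card S = 1")
  case True
  \<comment> \<open>For one element the counting bound is 2, while e \<ge> 2 gives e^2 \<ge>
    4.\<close>
  have "(1 + 1 :: real)\<^sup>2 \<le> (exp 1)\<^sup>2"
    using exp_ge_add_one_self[of "1 :: real"] by (intro power_mono) auto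
  then show ?thesis
    using card_arcs_so_network_le[OF assms(1)] True by (simp add: power2_eq_square)
next
  case False
  have "real (card (arcs (so_network S))) \<le> 2 * fact (card S) * (\<Sum>k<card S. 1 / fact k)\<^sup>2"
    by (rule card_arcs_so_network_le) fact
  also have "\<dots> \<le> real (card S) * fact (card S) * (exp 1)\<^sup>2"
    using False assms(2)
    by (intro mult_mono power_mono sum_inverse_fact_le_exp) (auto intro: sum_nonneg)
  finally show ?thesis
    by (simp add: mult_ac)
qed

section \<open>The extended formulation\<close>

text \<open>A linear map commutes with convex hulls, so it suffices to match path vectors with
  semiorder vectors.\<close>

theorem so_projection_flow_polytope:
  assumes "finite S"
  shows "so_projection S ` flow_polytope (so_network S) so_source (so_sink S) = semiorder_polytope S"
proof -
  interpret digraph "so_network S"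
    by (rule digraph_so_network) fact
  have "so_projection S ` {indicator (set p) | p. apath so_source p (so_sink S)} =
      {indicator R | R. semiorder_on S R}"
  proof (intro equalityI subsetI)
    fix x assume "x \<in> so_projection S ` {indicator (set p) | p. apath so_source p (so_sink S)}"
    then obtain p where "apath so_source p (so_sink S)" "x = so_projection S (indicator (set p))"
      by auto
    then show "x \<in> {indicator R | R. semiorder_on S R}"
      using so_projection_awalk[OF assms, of p] by (auto simp: apath_def)
  next
    fix x :: "'a \<times> 'a \<Rightarrow> real" assume "x \<in> {indicator R | R. semiorder_on S R}"
    then obtain R where "semiorder_on S R" "x = indicator R"
      by auto
    then obtain p where "awalk so_source p (so_sink S)" "so_projection S (indicator (set p)) = x"
      using exists_awalk_of_semiorder[OF assms] by metis
    then show "x \<in> so_projection S ` {indicator (set p) | p. apath so_source p (so_sink S)}"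
      using acyclic_awalk_imp_apath[OF acyclic_so_network[OF assms]] by blast
  qed
  then show ?thesis
    by (simp add: flow_polytope_def semiorder_polytope_def
        convex_hull_linear_image[OF linear_so_projection])
qed

lemma polytope_semiorder_polytope:
  assumes "finite S"
  shows "polytope (semiorder_polytope S)"
proof -
  have "finite {R. semiorder_on S R}"
    by (rule finite_subset[of _ "Pow (S \<times> S)"]) (use assms in \<open>auto simp: semiorder_on_def\<close>)
  then have "finite ((\<lambda>R. indicator R :: 'a \<times> 'a \<Rightarrow> real) ` {R. semiorder_on S R})"
    by simp
  then show ?thesis
    by (auto simp: polytope_def semiorder_polytope_def setcompr_eq_image)
qed

theorem theorem4:
  fixes S :: "'a set" and n :: nat
  assumes "finite S" and "card S = n" and "n \<ge> 1"
  shows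
    "so_projection S ` flow_polytope (so_network S) so_source (so_sink S) = semiorder_polytope S \<and>
     solutions (canonical_description (so_network S) so_source (so_sink S)) =
       flow_polytope (so_network S) so_source (so_sink S) \<and>
     extended_formulation (canonical_description (so_network S) so_source (so_sink S))
       (semiorder_polytope S) \<and>
     system_size (canonical_description (so_network S) so_source (so_sink S)) =
       card (arcs (so_network S)) \<and>
     real (card (arcs (so_network S))) \<le> (exp 1)\<^sup>2 * real n * fact n"
proof -
  interpret digraph "so_network S"
    by (rule digraph_so_network) fact
  let ?D = "so_network S"
  \<comment> \<open>Source and sink differ because \<open>S\<close> is nonempty.\<close>
  have st: "so_source \<in> verts ?D" "so_sink S \<in> verts ?D" "so_source \<noteq> so_sink S"
    using queue_node_in_so_nodes[of "[]" "{}" S] queue_node_in_so_nodes[of "[]" S S] assms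
    by (auto simp: so_source_def so_sink_def queue_node_def so_network_def)
  have proj: "so_projection S ` flow_polytope ?D so_source (so_sink S) = semiorder_polytope S"
    by (rule so_projection_flow_polytope) fact
  have sol: "solutions (canonical_description ?D so_source (so_sink S)) =
      flow_polytope ?D so_source (so_sink S)"
    by (rule solutions_canonical_description_eq_flow_polytope[OF acyclic_so_network[OF assms(1)] st])
  have "affine_map (so_projection S)"
    unfolding affine_map_def
    by (intro exI[of _ "so_projection S"] exI[of _ 0]) (simp add: linear_so_projection)
  then have "extended_formulation (canonical_description ?D so_source (so_sink S)) (semiorder_polytope S)"
    using proj polytope_semiorder_polytope[OF assms(1)] polytope_flow_polytope
      finite_system_canonical_description
    by (auto simp: extended_formulation_def sol)
  with proj sol show ?thesis
    using system_size_canonical_description card_arcs_so_network_le_exp[of S] assms by simp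
qed

end
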